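(* Let $f$ be a smooth symmetric function on a cone $\Gamma\subset\mathbb{R}^n$ (as in the context) such that $f$ is concave in $\Gamma$ and $\lim_{t\to+\infty}f(t\lambda)>f(\mu)$ for all $\lambda,\mu\in\Gamma$. Let $\varrho$ be a constant with $$\varrho<\frac1{1-\kappa_\Gamma\vartheta_\Gamma},\qquad\varrho\neq0$$ (so that $\varrho<n$). Define $$\tilde\Gamma=\Big\{(\lambda_1,\cdots,\lambda_n):\ \lambda_i=\frac1\varrho\Big(\sum_{j=1}^n\mu_j-(n-\varrho)\mu_i\Big),\ (\mu_1,\cdots,\mu_n)\in\Gamma\Big\}$$ and $\tilde f(\lambda)=f(\mu)$ for $\lambda\in\tilde\Gamma$, where $\mu_i=\frac1{n-\varrho}\big(\sum_{j=1}^n\lambda_j-\varrho\lambda_i\big)$. Then there is a uniform constant $\theta>0$ such that $$\frac{\partial\tilde f}{\partial\lambda_i}(\lambda)\geq\theta\sum_{j=1}^n\frac{\partial\tilde f}{\partial\lambda_j}(\lambda)>0\quad\text{for all }\lambda\in\tilde\Gamma,\ 1\leq i\leq n .$$ Moreover, $\tilde f$ is concave in $\tilde\Gamma$ and $\lim_{t\to+\infty}\tilde f(t\lambda)>\tilde f(\mu)$ for all $\lambda,\mu\in\tilde\Gamma$.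
   Context: $\Gamma\subset\mathbb{R}^n$ is an open symmetric (permutation invariant) convex cone with vertex at the origin, $\partial\Gamma\neq\emptyset$, containing the positive cone $\Gamma_n=\{\lambda:\lambda_i>0\ \forall i\}$. $\kappa_\Gamma=\max\{k:(\underbrace{0,\cdots,0}_{k},\underbrace{1,\cdots,1}_{n-k})\in\Gamma\}$. $\vartheta_\Gamma>0$ is a constant depending only on $\Gamma$ such that every smooth symmetric concave function $\phi$ on $\Gamma$ with $\lim_{t\to+\infty}\phi(t\lambda)>\phi(\mu)$ for all $\lambda,\mu\in\Gamma$ satisfies $\phi_i(\lambda)\geq\vartheta_\Gamma\sum_{j=1}^n\phi_j(\lambda)$ for $1\leq i\leq\kappa_\Gamma+1$ and all $\lambda\in\Gamma$ with $\lambda_1\leq\cdots\leq\lambda_n$ (here $\phi_i=\partial\phi/\partial\lambda_i$). Such a constant exists; when $\Gamma\neq\Gamma_n$ one may take $\vartheta_\Gamma=\sup\frac{\alpha_1/n}{\sum_{i=\kappa_\Gamma+1}^n\alpha_i-\sum_{i=2}^{\kappa_\Gamma}\alpha_i}$, the supremum over all $\alpha_i>0$ with $(-\alpha_1,\cdots,-\alpha_{\kappa_\Gamma},\alpha_{\kappa_\Gamma+1},\cdots,\alpha_n)\in\Gamma$. *)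

theory Defs
  imports "HOL-Analysis.Analysis"
begin

(* The index type of a vector is a finite linear order; pos i in {1..n} is the number that the
   index i has in the notation (x_1, ..., x_n). *)
definition pos :: "'n::{finite,linorder} \<Rightarrow> nat" where
  "pos i = card {..i}"

definition permute_vec :: "('n \<Rightarrow> 'n) \<Rightarrow> real^'n \<Rightarrow> real^'n" where
  "permute_vec \<sigma> x = (\<chi> i. x $ \<sigma> i)"

definition positive_cone :: "(real^'n) set" where
  "positive_cone = {x. \<forall>i. 0 < x $ i}"

(* The library predicates cone and conic require closure under multiplication by 0 and so
   exclude open cones other than the whole space; here only t > 0 is used. *)
definition symmetric_open_cone :: "(real^'n) set \<Rightarrow> bool" where
  "symmetric_open_cone \<Gamma> \<longleftrightarrow>
     open \<Gamma> \<and> convex \<Gamma> \<and>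
     (\<forall>x\<in>\<Gamma>. \<forall>t>0. t *\<^sub>R x \<in> \<Gamma>) \<and>
     (\<forall>\<sigma>. \<sigma> permutes UNIV \<longrightarrow> (\<forall>x\<in>\<Gamma>. permute_vec \<sigma> x \<in> \<Gamma>)) \<and>
     frontier \<Gamma> \<noteq> {} \<and> positive_cone \<subseteq> \<Gamma>"

definition kappa :: "(real^'n::{finite,linorder}) set \<Rightarrow> nat" where
  "kappa \<Gamma> = Max {k. k \<le> CARD('n) \<and> (\<chi> i. if pos i \<le> k then 0 else 1) \<in> \<Gamma>}"

definition partial :: "'n \<Rightarrow> (real^'n \<Rightarrow> real) \<Rightarrow> real^'n \<Rightarrow> real" where
  "partial i f x = deriv (\<lambda>t. f (x + t *\<^sub>R axis i 1)) 0"

(* Only meaningful for open S: derivatives are full derivatives at the points of S. *)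
fun Ck_on :: "nat \<Rightarrow> (real^'n) set \<Rightarrow> (real^'n \<Rightarrow> real) \<Rightarrow> bool" where
  "Ck_on 0 S f \<longleftrightarrow> continuous_on S f"
| "Ck_on (Suc k) S f \<longleftrightarrow> (\<forall>x\<in>S. f differentiable (at x)) \<and> (\<forall>i. Ck_on k S (partial i f))"

definition smooth_on :: "(real^'n) set \<Rightarrow> (real^'n \<Rightarrow> real) \<Rightarrow> bool" where
  "smooth_on S f \<longleftrightarrow> (\<forall>k. Ck_on k S f)"

definition symmetric_on :: "(real^'n) set \<Rightarrow> (real^'n \<Rightarrow> real) \<Rightarrow> bool" where
  "symmetric_on S f \<longleftrightarrow> (\<forall>\<sigma>. \<sigma> permutes UNIV \<longrightarrow> (\<forall>x\<in>S. f (permute_vec \<sigma> x) = f x))"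

(* lim f(t x) > f(y) as t tends to infinity; the limit is taken in the extended reals, since
   it may be infinite (for instance for f = sum of log x_i on the positive cone). *)
definition limit_condition :: "(real^'n) set \<Rightarrow> (real^'n \<Rightarrow> real) \<Rightarrow> bool" where
  "limit_condition S f \<longleftrightarrow>
     (\<forall>x\<in>S. \<forall>y\<in>S. \<exists>L. ((\<lambda>t::real. ereal (f (t *\<^sub>R x))) \<longlongrightarrow> L) at_top \<and> ereal (f y) < L)"

definition admissible_function :: "(real^'n) set \<Rightarrow> (real^'n \<Rightarrow> real) \<Rightarrow> bool" where
  "admissible_function \<Gamma> f \<longleftrightarrow>
     smooth_on \<Gamma> f \<and> symmetric_on \<Gamma> f \<and> concave_on \<Gamma> f \<and> limit_condition \<Gamma> f"

(* \<tau> is an admissible choice of the constant attached to \<Gamma>; mono (vec_nth x) says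
   that x_1 \<le> ... \<le> x_n. *)
definition theta_constant :: "(real^'n::{finite,linorder}) set \<Rightarrow> real \<Rightarrow> bool" where
  "theta_constant \<Gamma> \<tau> \<longleftrightarrow>
     0 < \<tau> \<and>
     (\<forall>\<phi>. admissible_function \<Gamma> \<phi> \<longrightarrow>
        (\<forall>x\<in>\<Gamma>. mono (vec_nth x) \<longrightarrow>
           (\<forall>i. pos i \<le> kappa \<Gamma> + 1 \<longrightarrow> partial i \<phi> x \<ge> \<tau> * (\<Sum>j\<in>UNIV. partial j \<phi> x))))"

definition cone_tilde :: "real \<Rightarrow> (real^'n) set \<Rightarrow> (real^'n) set" where
  "cone_tilde \<rho> \<Gamma> =
     (\<lambda>\<mu>. \<chi> i. 1 / \<rho> * ((\<Sum>j\<in>UNIV. \<mu> $ j) - (real CARD('n) - \<rho>) * \<mu> $ i)) ` \<Gamma>"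

(* Defined on the whole space, but only its values on cone_tilde \<rho> \<Gamma> matter. *)
definition fun_tilde :: "real \<Rightarrow> (real^'n \<Rightarrow> real) \<Rightarrow> real^'n \<Rightarrow> real" where
  "fun_tilde \<rho> f x =
     f (\<chi> i. 1 / (real CARD('n) - \<rho>) * ((\<Sum>j\<in>UNIV. x $ j) - \<rho> * x $ i))"

end

theory Submission
  imports Defs
begin

text \<open>
  Concavity and the growth condition make the gradient of an admissible \<open>f\<close> pair positively with
  every vector of \<open>\<Gamma>\<close>; hence \<open>f\<^sub>i \<ge> 0\<close> and \<open>F = \<Sum>\<^sub>j f\<^sub>j > 0\<close>. Of the \<open>\<kappa> + 1\<close> indices of the
  smallest coordinates at least \<open>\<kappa>\<close> differ from \<open>i\<close>, and each of their derivatives is at least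
  \<open>\<tau> F\<close>; so \<open>f\<^sub>i \<le> (1 - \<kappa> \<tau>) F\<close> for every \<open>i\<close>. As \<open>\<partial>\<^sub>i\<close> of the transformed function is
  \<open>(F - \<rho> f\<^sub>i) / (n - \<rho>)\<close>, both signs of \<open>\<rho>\<close> give a uniform lower bound. The bound \<open>\<rho> < n\<close> comes
  from applying the property defining \<open>\<tau>\<close> to the sum of the coordinates.
\<close>

section \<open>Sorting coordinates\<close>

lemma strict_mono_pos: "strict_mono (pos :: 'n::{finite,linorder} \<Rightarrow> nat)"
proof (rule strict_monoI)
  fix i j :: 'n assume "i < j"
  then have "{..i} \<subset> {..j}" by auto
  then show "pos i < pos j" unfolding pos_def by (intro psubset_card_mono) auto
qed

lemma bij_betw_pos: "bij_betw pos (UNIV :: 'n::{finite,linorder} set) {1..CARD('n)}"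
proof -
  have inj: "inj (pos :: 'n \<Rightarrow> nat)"
    by (simp add: strict_mono_imp_inj_on strict_mono_pos)
  have "pos i \<in> {1..CARD('n)}" for i :: 'n
  proof -
    have "card {..i} > 0" by (auto simp: card_gt_0_iff)
    moreover have "card {..i} \<le> CARD('n)" by (intro card_mono) auto
    ultimately show ?thesis by (simp add: pos_def)
  qed
  then have "range (pos :: 'n \<Rightarrow> nat) \<subseteq> {1..CARD('n)}" by blast
  then have "range (pos :: 'n \<Rightarrow> nat) = {1..CARD('n)}"
    by (intro card_subset_eq) (auto simp: card_image inj)
  then show ?thesis using inj by (simp add: bij_betw_def)
qed

lemma card_pos_le:
  assumes "k \<le> CARD('n::{finite,linorder})"
  shows "card {i::'n. pos i \<le> k} = k"
proof -
  have "pos ` {i::'n. pos i \<le> k} = range (pos :: 'n \<Rightarrow> nat) \<inter> {..k}" by auto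
  also have "\<dots> = {1..k}"
    using bij_betw_pos[where 'n='n] assms by (auto simp: bij_betw_def)
  finally have "bij_betw pos {i::'n. pos i \<le> k} {1..k}"
    by (intro bij_betw_subset[OF bij_betw_pos]) auto
  then show ?thesis by (simp add: bij_betw_same_card)
qed

text \<open>\<open>theta_constant\<close> speaks only of points with nondecreasing coordinates; this
  reduces an arbitrary point to that case.\<close>

lemma ex_sorting_permutation:
  fixes x :: "real^'n::{finite,linorder}"
  shows "\<exists>\<sigma>. \<sigma> permutes UNIV \<and> mono (vec_nth (permute_vec \<sigma> x))"
proof -
  \<comment> \<open>\<open>M\<close> lists the indices by increasing coordinate. \<open>pos\<close>
    counts from 1 and list positions from 0, hence the shift \<open>pos i - 1\<close> below.\<close>
  define M where "M = sort_key (vec_nth x) (sorted_list_of_set (UNIV :: 'n set))"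
  have M: "distinct M" "set M = UNIV" "length M = CARD('n)" "sorted (map (vec_nth x) M)"
    by (auto simp: M_def)
  define \<sigma> where "\<sigma> i = M ! (pos i - 1)" for i :: 'n
  have pos: "1 \<le> pos i" "pos i \<le> CARD('n)" for i :: 'n
    using bij_betw_pos[where 'n='n] by (auto simp: bij_betw_def)
  have "inj \<sigma>"
  proof (rule injI)
    fix i j assume "\<sigma> i = \<sigma> j"
    then have "pos i - 1 = pos j - 1"
      using M pos[of i] pos[of j] by (simp add: \<sigma>_def nth_eq_iff_index_eq)
    then have "pos i = pos j" using pos[of i] pos[of j] by simp
    then show "i = j" using strict_mono_pos by (metis strict_mono_eq)
  qed
  then have "\<sigma> permutes UNIV"
    by (intro bij_imp_permutes) (auto simp: bij_def finite_UNIV_inj_surj)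
  moreover have "mono (vec_nth (permute_vec \<sigma> x))"
  proof (rule monoI)
    fix i j :: 'n assume "i \<le> j"
    then have "pos i \<le> pos j" by (simp add: strict_mono_less_eq[OF strict_mono_pos])
    then have "map (vec_nth x) M ! (pos i - 1) \<le> map (vec_nth x) M ! (pos j - 1)"
      using M pos[of j] by (intro sorted_nth_mono) auto
    then show "permute_vec \<sigma> x $ i \<le> permute_vec \<sigma> x $ j"
      using M pos[of i] pos[of j] by (simp add: permute_vec_def \<sigma>_def)
  qed
  ultimately show ?thesis by blast
qed

section \<open>Partial derivatives\<close>

lemma partial_eq_derivative:
  assumes "(f has_derivative D) (at x)"
  shows "partial i f x = D (axis i 1)"
proof -
  have "((\<lambda>t. f (x + t *\<^sub>R axis i 1)) has_derivative (\<lambda>t. D (t *\<^sub>R axis i 1))) (at 0)"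
    by (rule has_derivative_compose[where g=f and s=UNIV, simplified])
       (use assms in \<open>auto intro!: derivative_eq_intros\<close>)
  moreover have "D (t *\<^sub>R axis i 1) = D (axis i 1) * t" for t
    using assms by (simp add: linear_cmul has_derivative_linear)
  ultimately have "((\<lambda>t. f (x + t *\<^sub>R axis i 1)) has_field_derivative D (axis i 1)) (at 0)"
    by (simp add: has_field_derivative_def)
  then show ?thesis unfolding partial_def by (rule DERIV_imp_deriv)
qed

lemma linear_eq_sum_axis:
  fixes D :: "real^'n \<Rightarrow> real"
  assumes "linear D"
  shows "D v = (\<Sum>j\<in>UNIV. v $ j * D (axis j 1))"
proof -
  have "D v = D (\<Sum>j\<in>UNIV. v $ j *\<^sub>R axis j 1)"
    using basis_expansion[of v] by (simp add: scalar_mult_eq_scaleR)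
  then show ?thesis using assms by (simp add: linear_sum linear_cmul)
qed

text \<open>\<open>permute_vec \<sigma>\<close> carries the line through \<open>x\<close> in
  direction \<open>axis (\<sigma> i) 1\<close> to the line through
  \<open>permute_vec \<sigma> x\<close> in direction \<open>axis i 1\<close>. Symmetry equates the
  values of \<open>f\<close> on the two lines while the first stays in \<open>S\<close>; by openness
  this holds near 0, which fixes the derivative there.\<close>

lemma partial_permute:
  assumes "open S" "symmetric_on S f" "\<sigma> permutes UNIV" "x \<in> S"
  shows "partial (\<sigma> i) f x = partial i f (permute_vec \<sigma> x)"
  unfolding partial_def
proof (rule deriv_cong_ev)
  have "open ((\<lambda>t::real. x + t *\<^sub>R axis (\<sigma> i) 1) -` S)"
    using assms(1) by (intro open_vimage continuous_intros)
  then have "eventually (\<lambda>t. x + t *\<^sub>R axis (\<sigma> i) 1 \<in> S) (nhds (0::real))"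
    using assms(4) eventually_nhds_in_open[of "(\<lambda>t::real. x + t *\<^sub>R axis (\<sigma> i) 1) -` S" 0]
    by simp
  then show "eventually (\<lambda>t. f (x + t *\<^sub>R axis (\<sigma> i) 1)
      = f (permute_vec \<sigma> x + t *\<^sub>R axis i 1)) (nhds (0::real))"
  proof (rule eventually_mono)
    fix t :: real assume "x + t *\<^sub>R axis (\<sigma> i) 1 \<in> S"
    then have "f (permute_vec \<sigma> (x + t *\<^sub>R axis (\<sigma> i) 1)) = f (x + t *\<^sub>R axis (\<sigma> i) 1)"
      using assms(2,3) by (simp add: symmetric_on_def)
    moreover have "permute_vec \<sigma> (x + t *\<^sub>R axis (\<sigma> i) 1) = permute_vec \<sigma> x + t *\<^sub>R axis i 1"
      using permutes_inj[OF assms(3)] by (auto simp: permute_vec_def vec_eq_iff axis_def inj_eq)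
    ultimately show "f (x + t *\<^sub>R axis (\<sigma> i) 1) = f (permute_vec \<sigma> x + t *\<^sub>R axis i 1)"
      by simp
  qed
qed simp

text \<open>Restriction to the line through \<open>x\<close> and \<open>y\<close> reduces this to
  the tangent inequality for the convex one-variable function \<open>- (f \<circ> l)\<close>, taken
  between the parameters 0 and 1.\<close>

lemma concave_on_below_tangent:
  fixes f :: "'a::real_normed_vector \<Rightarrow> real"
  assumes f: "concave_on S f" "open S" and xy: "x \<in> S" "y \<in> S"
    and D: "(f has_derivative D) (at x)"
  shows "f y \<le> f x + D (y - x)"
proof -
  define l where "l s = x + s *\<^sub>R (y - x)" for s :: real
  define A where "A = l -` S"
  have l: "l (u * s + v * t) = u *\<^sub>R l s + v *\<^sub>R l t" if "u + v = 1" for u v s t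
  proof -
    have "u *\<^sub>R l s + v *\<^sub>R l t = (u + v) *\<^sub>R x + (u * s + v * t) *\<^sub>R (y - x)"
      by (simp add: l_def algebra_simps)
    then show ?thesis using that by (simp add: l_def)
  qed
  have conc: "concave_on A (f \<circ> l)"
    unfolding concave_on_iff
  proof (intro conjI ballI allI impI)
    show "convex A" using f(1) by (simp add: concave_on_iff convex_def A_def l)
  qed (use f(1) in \<open>simp add: concave_on_iff A_def l\<close>)
  have "open A" unfolding A_def l_def
    by (intro open_vimage f continuous_intros)
  have "convex A" using conc by (simp add: concave_on_iff)
  have "0 \<in> A" "1 \<in> A" using xy by (simp_all add: A_def l_def)
  have "((f \<circ> l) has_derivative (\<lambda>s. D (s *\<^sub>R (y - x)))) (at 0)"
    unfolding comp_def l_def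
    by (rule has_derivative_compose[where g=f and s=UNIV, simplified])
       (use D in \<open>auto intro!: derivative_eq_intros\<close>)
  moreover have "D (s *\<^sub>R (y - x)) = D (y - x) * s" for s
    using linear_cmul[OF has_derivative_linear[OF D]] by simp
  ultimately have "((f \<circ> l) has_field_derivative D (y - x)) (at 0)"
    by (simp add: has_field_derivative_def)
  then have "((\<lambda>s. - (f \<circ> l) s) has_field_derivative - D (y - x)) (at 0 within A)"
    by (intro DERIV_minus[OF has_field_derivative_at_within])
  then have "- (f \<circ> l) 1 - (- (f \<circ> l) 0) \<ge> - D (y - x) * (1 - 0)"
    using conc \<open>open A\<close> \<open>convex A\<close> \<open>0 \<in> A\<close> \<open>1 \<in> A\<close>
    by (intro convex_on_imp_above_tangent[where A=A])
       (simp_all add: convex_connected interior_open concave_on_def)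
  then show ?thesis by (simp add: l_def)
qed

section \<open>Gradients of admissible functions\<close>

lemma admissible_differentiable:
  assumes "admissible_function \<Gamma> f" "x \<in> \<Gamma>"
  shows "f differentiable (at x)"
proof -
  have "Ck_on (Suc 0) \<Gamma> f" using assms(1) unfolding admissible_function_def smooth_on_def by blast
  then show ?thesis using assms(2) by simp
qed

text \<open>The tangent at \<open>x\<close> gives
  \<open>f (t *\<^sub>R z) \<le> f x + (t * D z - D x)\<close>. If the bracket were eventually
  nonpositive, the limit along the ray of \<open>z\<close> could not exceed \<open>f x\<close>,
  against the growth condition with \<open>x\<close> as comparison point.\<close>

lemma admissible_derivative_pos:
  assumes \<Gamma>: "symmetric_open_cone \<Gamma>" and f: "admissible_function \<Gamma> f"
    and x: "x \<in> \<Gamma>" and D: "(f has_derivative D) (at x)" and y: "y \<in> \<Gamma>"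
  shows "D y > 0"
proof -
  have lin: "linear D" using D by (rule has_derivative_linear)
  have le: "f (t *\<^sub>R z) \<le> f x + (t * D z - D x)" if "z \<in> \<Gamma>" "t > 0" for z t
    using concave_on_below_tangent[OF _ _ x _ D, of "t *\<^sub>R z"] f \<Gamma> that
    by (simp add: admissible_function_def symmetric_open_cone_def linear_diff[OF lin]
        linear_cmul[OF lin])
  have lim: "limit_condition \<Gamma> f" using f by (simp add: admissible_function_def)
  have not_le: "\<not> (\<forall>\<^sub>F t in at_top. f (t *\<^sub>R z) \<le> f x)" if "z \<in> \<Gamma>" for z
  proof
    assume ev: "\<forall>\<^sub>F t in at_top. f (t *\<^sub>R z) \<le> f x"
    have "\<exists>L. ((\<lambda>t::real. ereal (f (t *\<^sub>R z))) \<longlongrightarrow> L) at_top \<and> ereal (f x) < L"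
      using lim that x by (simp add: limit_condition_def)
    then obtain L where L: "((\<lambda>t::real. ereal (f (t *\<^sub>R z))) \<longlongrightarrow> L) at_top" "ereal (f x) < L"
      by (elim exE conjE)
    have "L \<le> ereal (f x)"
      by (rule tendsto_upperbound[OF L(1)]) (use ev in auto)
    then show False using L(2) by simp
  qed
  have nonneg: "D z \<ge> 0" if z: "z \<in> \<Gamma>" for z
  proof (rule ccontr)
    assume neg: "\<not> D z \<ge> 0"
    \<comment> \<open>Dividing by the negative number \<open>D z\<close> reverses the inequality, so
      this threshold yields \<open>t * D z \<le> D x\<close>; the 1 keeps \<open>t\<close>
      positive.\<close>
    have "f (t *\<^sub>R z) \<le> f x" if t: "t \<ge> max 1 (D x / D z)" for t
    proof -
      have "t * D z \<le> D x" using t neg by (simp add: neg_divide_le_eq)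
      then show ?thesis using le[OF z, of t] t by simp
    qed
    then have "\<forall>\<^sub>F t in at_top. f (t *\<^sub>R z) \<le> f x" by (rule eventually_at_top_linorderI)
    then show False using not_le[OF z] by simp
  qed
  \<comment> \<open>With \<open>D y = 0\<close> the tangent bound is \<open>f x - D x\<close>, so
    the nonnegativity just proved is used at \<open>x\<close> itself.\<close>
  have "D y \<noteq> 0"
  proof
    assume "D y = 0"
    then have "f (t *\<^sub>R y) \<le> f x" if "t \<ge> 1" for t
      using le[OF y, of t] nonneg[OF x] that by simp
    then have "\<forall>\<^sub>F t in at_top. f (t *\<^sub>R y) \<le> f x" by (rule eventually_at_top_linorderI)
    then show False using not_le[OF y] by simp
  qed
  then show ?thesis using nonneg[OF y] by simp
qed

lemma admissible_partials:
  fixes \<Gamma> :: "(real^'n) set"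
  assumes \<Gamma>: "symmetric_open_cone \<Gamma>" and f: "admissible_function \<Gamma> f" and x: "x \<in> \<Gamma>"
  shows "partial i f x \<ge> 0" "(\<Sum>j\<in>UNIV. partial j f x) > 0"
proof -
  obtain D where D: "(f has_derivative D) (at x)"
    using admissible_differentiable[OF f x] by (auto simp: differentiable_def)
  have lin: "linear D" using D by (rule has_derivative_linear)
  have p: "partial j f x = D (axis j 1)" for j by (rule partial_eq_derivative[OF D])
  have pos: "D v > 0" if "\<And>j. v $ j > 0" for v
  proof -
    have "v \<in> positive_cone" using that by (simp add: positive_cone_def)
    then have "v \<in> \<Gamma>" using \<Gamma> by (auto simp: symmetric_open_cone_def)
    then show ?thesis by (rule admissible_derivative_pos[OF \<Gamma> f x D])
  qed
  have "D (\<chi> j. 1) > 0" by (rule pos) simp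
  then show sum: "(\<Sum>j\<in>UNIV. partial j f x) > 0"
    using linear_eq_sum_axis[OF lin, of "\<chi> j. 1"] by (simp add: p)
  show "partial i f x \<ge> 0"
  proof (rule field_le_epsilon)
    fix e :: real assume "e > 0"
    \<comment> \<open>In general \<open>axis i 1\<close> lies only in the closure of the positive
      cone, so a multiple of the all-ones vector is added; \<open>s\<close> is chosen to make its
      contribution to \<open>D\<close> exactly \<open>e\<close>.\<close>
    define s where "s = e / D (\<chi> j. 1)"
    have "s > 0" using \<open>e > 0\<close> \<open>D (\<chi> j. 1) > 0\<close> by (simp add: s_def)
    then have "D (axis i 1 + s *\<^sub>R (\<chi> j. 1)) > 0" by (intro pos) (simp add: axis_def)
    then show "0 \<le> partial i f x + e"
      using \<open>D (\<chi> j. 1) > 0\<close> by (simp add: p linear_add[OF lin] linear_cmul[OF lin] s_def)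
  qed
qed

text \<open>Lower bounds on the other derivatives become an upper bound on this one. The case
  \<open>\<rho> > 0\<close> needs it, since there a large partial derivative of \<open>f\<close>
  lowers the transformed one.\<close>

lemma partial_le_fraction_of_sum:
  fixes \<Gamma> :: "(real^'n::{finite,linorder}) set"
  assumes \<Gamma>: "symmetric_open_cone \<Gamma>" and \<tau>: "theta_constant \<Gamma> \<tau>"
    and kappa: "kappa \<Gamma> < CARD('n)"
    and f: "admissible_function \<Gamma> f" and x: "x \<in> \<Gamma>"
  shows "partial i f x \<le> (1 - real (kappa \<Gamma>) * \<tau>) * (\<Sum>j\<in>UNIV. partial j f x)"
proof -
  obtain \<sigma> where \<sigma>: "\<sigma> permutes UNIV" and mono: "mono (vec_nth (permute_vec \<sigma> x))"
    using ex_sorting_permutation by blast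
  define y where "y = permute_vec \<sigma> x"
  have y: "y \<in> \<Gamma>" using \<Gamma> \<sigma> x unfolding y_def symmetric_open_cone_def by blast
  have p: "partial (\<sigma> j) f x = partial j f y" for j
    using partial_permute[of \<Gamma> f \<sigma> x j] \<Gamma> f \<sigma> x
    by (simp add: symmetric_open_cone_def admissible_function_def y_def)
  define F where "F = (\<Sum>j\<in>UNIV. partial j f y)"
  have F: "(\<Sum>j\<in>UNIV. partial j f x) = F"
    using sum.permute[OF \<sigma>, of "\<lambda>j. partial j f x"] by (simp add: F_def p comp_def)
  have "F > 0" unfolding F_def by (rule admissible_partials[OF \<Gamma> f y])
  have "\<tau> > 0" using \<tau> by (simp add: theta_constant_def)
  have low: "partial j f y \<ge> \<tau> * F" if "pos j \<le> kappa \<Gamma> + 1" for j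
    using \<tau> f y mono that unfolding theta_constant_def F_def y_def by blast
  obtain k where k: "i = \<sigma> k" using permutes_surj[OF \<sigma>] by (metis surjD)
  \<comment> \<open>The index \<open>k\<close> may or may not be among the first
    \<open>kappa \<Gamma> + 1\<close>; at least \<open>kappa \<Gamma>\<close> indices remain either
    way.\<close>
  define B where "B = {j::'n. pos j \<le> kappa \<Gamma> + 1} - {k}"
  have "card {j::'n. pos j \<le> kappa \<Gamma> + 1} = kappa \<Gamma> + 1"
    using kappa by (intro card_pos_le) simp
  then have "kappa \<Gamma> \<le> card B" unfolding B_def by (auto simp: card_Diff_singleton_if)
  then have "real (kappa \<Gamma>) * (\<tau> * F) \<le> real (card B) * (\<tau> * F)"
    using \<open>\<tau> > 0\<close> \<open>F > 0\<close> by (intro mult_right_mono) auto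
  also have "\<dots> \<le> (\<Sum>j\<in>B. partial j f y)"
    by (rule sum_bounded_below) (use low in \<open>auto simp: B_def\<close>)
  \<comment> \<open>The indices added to \<open>B\<close> contribute nonnegative
    derivatives.\<close>
  also have "\<dots> \<le> (\<Sum>j\<in>UNIV - {k}. partial j f y)"
    by (intro sum_mono2) (auto simp: B_def admissible_partials(1)[OF \<Gamma> f y])
  also have "\<dots> = F - partial k f y" unfolding F_def by (subst sum_diff) auto
  finally show ?thesis by (simp add: F k p algebra_simps)
qed

section \<open>The sum of the coordinates\<close>

text \<open>The sum is twice the midpoint.\<close>

lemma symmetric_open_cone_add:
  assumes "symmetric_open_cone \<Gamma>" "x \<in> \<Gamma>" "y \<in> \<Gamma>"
  shows "x + y \<in> \<Gamma>"
proof -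
  have "(1/2) *\<^sub>R x + (1/2) *\<^sub>R y \<in> \<Gamma>"
    using assms unfolding symmetric_open_cone_def by (auto intro!: convexD)
  then have "2 *\<^sub>R ((1/2) *\<^sub>R x + (1/2) *\<^sub>R y) \<in> \<Gamma>"
    using assms(1) by (simp add: symmetric_open_cone_def)
  then show ?thesis by (simp add: scaleR_add_right)
qed

text \<open>A ball around 0 inside \<open>\<Gamma>\<close> would fill the whole space by scaling,
  and the whole space has empty frontier.\<close>

lemma zero_notin_symmetric_open_cone:
  fixes \<Gamma> :: "(real^'n) set"
  assumes \<Gamma>: "symmetric_open_cone \<Gamma>"
  shows "0 \<notin> \<Gamma>"
proof
  assume "0 \<in> \<Gamma>"
  then obtain e where e: "e > 0" "ball 0 e \<subseteq> \<Gamma>"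
    using \<Gamma> unfolding symmetric_open_cone_def by (meson openE)
  have "v \<in> \<Gamma>" for v
  proof -
    \<comment> \<open>The summand 1 avoids a zero denominator at \<open>v = 0\<close>.\<close>
    define t where "t = e / (2 * (norm v + 1))"
    have n: "norm v + 1 > 0" by (simp add: add_nonneg_pos)
    have "t > 0" using e n by (simp add: t_def)
    have "t * norm v \<le> e / 2" using e n by (simp add: t_def field_simps)
    then have "t *\<^sub>R v \<in> ball 0 e" using e \<open>t > 0\<close> by simp
    then have "t *\<^sub>R v \<in> \<Gamma>" using e by blast
    moreover have "1 / t > 0" using \<open>t > 0\<close> by simp
    ultimately have "(1 / t) *\<^sub>R (t *\<^sub>R v) \<in> \<Gamma>"
      using \<Gamma> unfolding symmetric_open_cone_def by blast
    then show ?thesis using \<open>t > 0\<close> by simp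
  qed
  then have "\<Gamma> = UNIV" by auto
  then show False using \<Gamma> by (simp add: symmetric_open_cone_def)
qed

text \<open>If all coordinates were nonpositive, openness would allow lowering them to negative
  values within \<open>\<Gamma>\<close>. The opposite vector lies in the positive cone, and adding
  the two puts 0 into \<open>\<Gamma>\<close>.\<close>

lemma not_nonpositive_in_symmetric_open_cone:
  fixes \<Gamma> :: "(real^'n) set"
  assumes \<Gamma>: "symmetric_open_cone \<Gamma>" and x: "x \<in> \<Gamma>"
  shows "\<exists>i. x $ i > 0"
proof (rule ccontr)
  assume "\<nexists>i. x $ i > 0"
  then have np: "x $ i \<le> 0" for i by (simp add: not_less)
  have "((\<lambda>t. x - t *\<^sub>R (\<chi> i. 1)) \<longlongrightarrow> x - 0 *\<^sub>R (\<chi> i. 1)) (at_right (0::real))"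
    by (intro tendsto_intros)
  then have "eventually (\<lambda>t. x - t *\<^sub>R (\<chi> i. 1) \<in> \<Gamma>) (at_right (0::real))"
    using \<Gamma> x by (simp add: symmetric_open_cone_def topological_tendstoD)
  then have "eventually (\<lambda>t. t > 0 \<and> x - t *\<^sub>R (\<chi> i. 1) \<in> \<Gamma>) (at_right (0::real))"
    by (intro eventually_conj) (auto simp: eventually_at_right_less)
  then obtain t :: real where t: "t > 0" "x - t *\<^sub>R (\<chi> i. 1) \<in> \<Gamma>"
    using eventually_happens[of _ "at_right (0::real)"] by auto
  have "- (x - t *\<^sub>R (\<chi> i. 1)) \<in> positive_cone"
    using t(1) le_less_trans[OF np t(1)] by (simp add: positive_cone_def)
  then have "- (x - t *\<^sub>R (\<chi> i. 1)) \<in> \<Gamma>" using \<Gamma> by (auto simp: symmetric_open_cone_def)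
  then have "0 \<in> \<Gamma>" using symmetric_open_cone_add[OF \<Gamma> t(2)] by fastforce
  then show False using zero_notin_symmetric_open_cone[OF \<Gamma>] by simp
qed

lemma sum_vec_permute:
  assumes "\<sigma> permutes UNIV"
  shows "(\<Sum>j\<in>UNIV. x $ \<sigma> j) = (\<Sum>j\<in>UNIV. x $ j)"
  using sum.permute[OF assms, of "vec_nth x", symmetric] unfolding comp_def .

text \<open>The vectors obtained from \<open>x\<close> by permutation add up to a multiple of \<open>(1, \<dots>, 1)\<close>.\<close>

lemma sum_pos_in_symmetric_open_cone:
  fixes \<Gamma> :: "(real^'n) set"
  assumes \<Gamma>: "symmetric_open_cone \<Gamma>" and x: "x \<in> \<Gamma>"
  shows "(\<Sum>i\<in>UNIV. x $ i) > 0"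
proof -
  define P where "P = {\<sigma>. \<sigma> permutes (UNIV :: 'n set)}"
  have P: "finite P" "id \<in> P" by (auto simp: P_def finite_permutations permutes_id)
  define S where "S = (\<Sum>\<sigma>\<in>P. permute_vec \<sigma> x)"
  \<comment> \<open>The induction runs over nonempty sets because the empty sum 0 is outside
    \<open>\<Gamma>\<close>.\<close>
  have "(\<Sum>\<sigma>\<in>Q. permute_vec \<sigma> x) \<in> \<Gamma>" if "finite Q" "Q \<noteq> {}" "Q \<subseteq> P" for Q
    using that
  proof (induction rule: finite_ne_induct)
    case (singleton \<sigma>)
    then show ?case using \<Gamma> x by (simp add: P_def symmetric_open_cone_def)
  next
    case (insert \<sigma> Q)
    then have "permute_vec \<sigma> x \<in> \<Gamma>" using \<Gamma> x by (simp add: P_def symmetric_open_cone_def)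
    then show ?case using insert by (simp add: symmetric_open_cone_add[OF \<Gamma>])
  qed
  then have "S \<in> \<Gamma>" using P unfolding S_def by blast
  then obtain k where k: "S $ k > 0" using not_nonpositive_in_symmetric_open_cone[OF \<Gamma>] by blast
  have S: "S $ j = (\<Sum>\<sigma>\<in>P. x $ \<sigma> j)" for j by (simp add: S_def permute_vec_def)
  \<comment> \<open>Composition with the transposition of \<open>j\<close> and \<open>k\<close> is
    an involution of \<open>P\<close> that exchanges the two coordinate sums.\<close>
  have const: "S $ j = S $ k" for j
    unfolding S
    by (rule sum.reindex_bij_witness[where i="\<lambda>\<sigma>. \<sigma> \<circ> Transposition.transpose j k"
          and j="\<lambda>\<sigma>. \<sigma> \<circ> Transposition.transpose j k"])
       (simp_all add: P_def comp_assoc permutes_compose permutes_swap_id)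
  have "(\<Sum>j\<in>UNIV. S $ j) = (\<Sum>j\<in>(UNIV :: 'n set). S $ k)"
    by (intro sum.cong refl const)
  then have sum_S: "(\<Sum>j\<in>UNIV. S $ j) = real CARD('n) * S $ k" by simp
  \<comment> \<open>Counting the other way: each permuted copy of \<open>x\<close> has the
    coordinate sum of \<open>x\<close>.\<close>
  have "(\<Sum>j\<in>UNIV. S $ j) = (\<Sum>\<sigma>\<in>P. \<Sum>j\<in>UNIV. x $ \<sigma> j)"
    unfolding S by (rule sum.swap)
  also have "\<dots> = (\<Sum>\<sigma>\<in>P. \<Sum>j\<in>UNIV. x $ j)"
    by (intro sum.cong refl sum_vec_permute) (simp add: P_def)
  finally have "real (card P) * (\<Sum>j\<in>UNIV. x $ j) = real CARD('n) * S $ k"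
    unfolding sum_S by simp
  also have "\<dots> > 0" using k by simp
  finally show ?thesis by (simp add: zero_less_mult_iff)
qed

lemma Ck_on_const: "Ck_on k S (\<lambda>x. c)"
proof (induction k arbitrary: c)
  case (Suc k)
  have "partial i (\<lambda>x. c) = (\<lambda>x. 0)" for i :: 'a by (simp add: partial_def fun_eq_iff)
  then show ?case using Suc by simp
qed simp

lemma partial_coordinate_sum:
  "partial i (\<lambda>x::real^'n. \<Sum>j\<in>UNIV. x $ j) x = 1"
proof -
  have "((\<lambda>x::real^'n. \<Sum>j\<in>UNIV. x $ j) has_derivative (\<lambda>x. \<Sum>j\<in>UNIV. x $ j)) (at x)"
    by (intro derivative_intros has_derivative_ident bounded_linear.has_derivative[OF bounded_linear_vec_nth])
  then have "partial i (\<lambda>x. \<Sum>j\<in>UNIV. x $ j) x = (\<Sum>j\<in>UNIV. axis i 1 $ j)"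
    by (rule partial_eq_derivative)
  then show ?thesis by (simp add: axis_def)
qed

text \<open>This is the test function for bounding \<open>\<tau>\<close>. Along a ray it equals
  \<open>t\<close> times a positive coordinate sum, so its limit is infinite.\<close>

lemma admissible_coordinate_sum:
  fixes \<Gamma> :: "(real^'n) set"
  assumes \<Gamma>: "symmetric_open_cone \<Gamma>"
  shows "admissible_function \<Gamma> (\<lambda>x. \<Sum>j\<in>UNIV. x $ j)"
  unfolding admissible_function_def
proof (intro conjI)
  have diff: "(\<lambda>x::real^'n. \<Sum>j\<in>UNIV. x $ j) differentiable (at x)" for x
    by (intro differentiable_sum ballI bounded_linear_imp_differentiable bounded_linear_vec_nth) simp
  have partial: "partial i (\<lambda>x::real^'n. \<Sum>j\<in>UNIV. x $ j) = (\<lambda>x. 1)" for i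
    by (simp add: partial_coordinate_sum fun_eq_iff)
  have "Ck_on k \<Gamma> (\<lambda>x. \<Sum>j\<in>UNIV. x $ j)" for k
    by (cases k) (auto simp: partial Ck_on_const diff intro!: continuous_intros)
  then show "smooth_on \<Gamma> (\<lambda>x. \<Sum>j\<in>UNIV. x $ j)" by (simp add: smooth_on_def)
  show "symmetric_on \<Gamma> (\<lambda>x. \<Sum>j\<in>UNIV. x $ j)"
    by (auto simp: symmetric_on_def permute_vec_def intro: sum_vec_permute)
  show "concave_on \<Gamma> (\<lambda>x. \<Sum>j\<in>UNIV. x $ j)"
    using \<Gamma> by (simp add: concave_on_iff symmetric_open_cone_def sum.distrib sum_distrib_left)
  show "limit_condition \<Gamma> (\<lambda>x. \<Sum>j\<in>UNIV. x $ j)"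
    unfolding limit_condition_def
  proof (intro ballI exI[of _ \<infinity>] conjI)
    fix x assume "x \<in> \<Gamma>"
    then have "(\<Sum>j\<in>UNIV. x $ j) > 0" by (rule sum_pos_in_symmetric_open_cone[OF \<Gamma>])
    then have "filterlim (\<lambda>t. t * (\<Sum>j\<in>UNIV. x $ j)) at_top at_top"
      by (intro filterlim_at_top_mult_tendsto_pos[OF tendsto_const] filterlim_ident) auto
    then show "((\<lambda>t. ereal (\<Sum>j\<in>UNIV. (t *\<^sub>R x) $ j)) \<longlongrightarrow> \<infinity>) at_top"
      by (simp add: tendsto_PInfty_eq_at_top flip: sum_distrib_left)
  qed simp
qed

text \<open>The value \<open>k = 0\<close> gives the all-ones vector, so the maximum is taken over a
  nonempty set and belongs to it; \<open>k = CARD('n)\<close> would give the zero vector.\<close>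

lemma kappa_less_dim:
  fixes \<Gamma> :: "(real^'n::{finite,linorder}) set"
  assumes \<Gamma>: "symmetric_open_cone \<Gamma>"
  shows "kappa \<Gamma> < CARD('n)"
proof -
  let ?K = "{k. k \<le> CARD('n) \<and> ((\<chi> i. if pos i \<le> k then 0 else 1) :: (real, 'n) vec) \<in> \<Gamma>}"
  have pos: "1 \<le> pos i" "pos i \<le> CARD('n)" for i :: 'n
    using bij_betw_pos[where 'n='n] by (auto simp: bij_betw_def)
  have "((\<chi> i. if pos i \<le> 0 then 0 else 1) :: (real, 'n) vec) \<in> positive_cone"
    using pos(1) by (auto simp: positive_cone_def not_le intro: less_le_trans[OF zero_less_one])
  then have "0 \<in> ?K" using \<Gamma> by (auto simp: symmetric_open_cone_def)
  moreover have "finite ?K" by simp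
  ultimately have K: "kappa \<Gamma> \<in> ?K" unfolding kappa_def by (intro Max_in) auto
  have "((\<chi> i. if pos i \<le> CARD('n) then 0 else 1) :: (real, 'n) vec) = 0"
    using pos by (simp add: vec_eq_iff)
  then have "CARD('n) \<notin> ?K" using zero_notin_symmetric_open_cone[OF \<Gamma>] by simp
  then have "kappa \<Gamma> \<noteq> CARD('n)" using K by metis
  then show ?thesis using K by simp
qed

text \<open>The coordinate sum has all partial derivatives equal to 1. At the all-ones vector, which
  is trivially sorted, and at the index of position 1, the inequality defining \<open>\<tau>\<close>
  becomes the claim.\<close>

lemma theta_constant_le:
  fixes \<Gamma> :: "(real^'n::{finite,linorder}) set"
  assumes \<Gamma>: "symmetric_open_cone \<Gamma>" and \<tau>: "theta_constant \<Gamma> \<tau>"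
  shows "real CARD('n) * \<tau> \<le> 1"
proof -
  have "1 \<in> pos ` (UNIV :: 'n set)"
    using bij_betw_pos[where 'n='n] by (simp add: bij_betw_def Suc_le_eq)
  then obtain i :: 'n where i: "pos i = 1" by (metis imageE)
  have 1: "((\<chi> j. 1) :: (real, 'n) vec) \<in> \<Gamma>"
    using \<Gamma> subsetD[of positive_cone \<Gamma>]
    by (simp add: symmetric_open_cone_def positive_cone_def)
  have mono: "mono (vec_nth ((\<chi> j. 1) :: (real, 'n) vec))" by (simp add: mono_def)
  have "partial i (\<lambda>x. \<Sum>j\<in>UNIV. x $ j) ((\<chi> j. 1) :: (real, 'n) vec)
      \<ge> \<tau> * (\<Sum>l\<in>UNIV. partial l (\<lambda>x. \<Sum>j\<in>UNIV. x $ j) ((\<chi> j. 1) :: (real, 'n) vec))"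
    using \<tau> admissible_coordinate_sum[OF \<Gamma>] 1 mono i unfolding theta_constant_def by simp
  then show ?thesis by (simp add: partial_coordinate_sum mult.commute)
qed

section \<open>The linear change of variables\<close>

text \<open>The passage from \<open>\<lambda>\<close> back to \<open>\<mu>\<close>, named so that
  \<open>fun_tilde\<close> becomes a composition and \<open>cone_tilde\<close> a preimage under one
  linear map.\<close>

definition tilde_inverse :: "real \<Rightarrow> real^'n \<Rightarrow> real^'n" where
  "tilde_inverse \<rho> x = (\<chi> i. 1 / (real CARD('n) - \<rho>) * ((\<Sum>j\<in>UNIV. x $ j) - \<rho> * x $ i))"

lemma fun_tilde_eq: "fun_tilde \<rho> f x = f (tilde_inverse \<rho> x)"
  by (simp add: fun_tilde_def tilde_inverse_def)

lemma linear_tilde_inverse: "linear (tilde_inverse \<rho>)"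
  by (rule linearI)
     (simp_all add: tilde_inverse_def vec_eq_iff sum.distrib algebra_simps diff_divide_distrib
       add_divide_distrib flip: sum_distrib_left)

lemma cone_tilde_eq:
  fixes \<Gamma> :: "(real^'n) set"
  assumes "\<rho> \<noteq> 0" "\<rho> < real CARD('n)"
  shows "cone_tilde \<rho> \<Gamma> = tilde_inverse \<rho> -` \<Gamma>"
proof -
  define T :: "real^'n \<Rightarrow> real^'n" where
    "T \<mu> = (\<chi> i. 1 / \<rho> * ((\<Sum>j\<in>UNIV. \<mu> $ j) - (real CARD('n) - \<rho>) * \<mu> $ i))" for \<mu>
  have sum: "(\<Sum>j\<in>UNIV. a * (s - b * v $ j)) = a * (real CARD('n) * s - b * (\<Sum>j\<in>UNIV. v $ j))"
    for a b s and v :: "real^'n"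
    unfolding sum_distrib_left[symmetric] sum_subtractf by simp
  \<comment> \<open>Both maps preserve the coordinate sum; with that sum fixed, each coordinate can
    be solved for separately, so they are mutually inverse.\<close>
  have sumT: "(\<Sum>j\<in>UNIV. T \<mu> $ j) = (\<Sum>j\<in>UNIV. \<mu> $ j)" for \<mu>
    using assms by (simp add: T_def sum del: times_divide_eq_left) (simp add: field_simps)
  have sumS: "(\<Sum>j\<in>UNIV. tilde_inverse \<rho> x $ j) = (\<Sum>j\<in>UNIV. x $ j)" for x :: "real^'n"
    using assms by (simp add: tilde_inverse_def sum del: times_divide_eq_left) (simp add: field_simps)
  have 1: "tilde_inverse \<rho> (T \<mu>) = \<mu>" for \<mu>
    using assms unfolding tilde_inverse_def sumT by (simp add: T_def vec_eq_iff field_simps)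
  have 2: "T (tilde_inverse \<rho> x) = x" for x
    using assms unfolding T_def sumS by (simp add: tilde_inverse_def vec_eq_iff field_simps)
  have "cone_tilde \<rho> \<Gamma> = T ` \<Gamma>" by (simp add: cone_tilde_def T_def)
  then show ?thesis using 1 2 by (auto simp: image_iff) metis
qed

lemma concave_on_linear_vimage:
  assumes "concave_on S f" "linear h"
  shows "concave_on (h -` S) (\<lambda>x. f (h x))"
  using assms convex_linear_vimage[of h S]
  by (auto simp: concave_on_iff linear_add linear_cmul)

lemma limit_condition_linear_vimage:
  assumes "limit_condition S f" "linear h"
  shows "limit_condition (h -` S) (\<lambda>x. f (h x))"
  using assms by (simp add: limit_condition_def linear_cmul)

lemma fun_tilde_derivative:
  fixes f :: "real^'n \<Rightarrow> real"
  assumes \<rho>: "\<rho> < real CARD('n)" and f: "f differentiable (at (tilde_inverse \<rho> x))"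
  shows "fun_tilde \<rho> f differentiable (at x)"
    and "partial i (fun_tilde \<rho> f) x
      = ((\<Sum>j\<in>UNIV. partial j f (tilde_inverse \<rho> x)) - \<rho> * partial i f (tilde_inverse \<rho> x))
        / (real CARD('n) - \<rho>)"
proof -
  obtain D where D: "(f has_derivative D) (at (tilde_inverse \<rho> x))"
    using f by (auto simp: differentiable_def)
  have lin: "linear D" using D by (rule has_derivative_linear)
  have der: "(fun_tilde \<rho> f has_derivative (\<lambda>v. D (tilde_inverse \<rho> v))) (at x)"
    unfolding fun_tilde_eq[abs_def]
    by (rule has_derivative_compose[where f="tilde_inverse \<rho>" and g=f and s=UNIV, OF _ D])
       (simp add: linear_imp_has_derivative linear_tilde_inverse)
  then show "fun_tilde \<rho> f differentiable (at x)" by (auto simp: differentiable_def)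
  \<comment> \<open>\<open>axis i 1\<close> has coordinate sum 1. Applying \<open>D\<close> to this
    image gives the numerator \<open>F - \<rho> f\<^sub>i\<close> by the chain rule.\<close>
  have ax: "tilde_inverse \<rho> (axis i 1)
      = (1 / (real CARD('n) - \<rho>)) *\<^sub>R ((\<chi> j. 1) - \<rho> *\<^sub>R axis i 1)"
    by (simp add: tilde_inverse_def vec_eq_iff axis_def)
  have "D (\<chi> j. 1) = (\<Sum>j\<in>UNIV. D (axis j 1))"
    using linear_eq_sum_axis[OF lin, of "\<chi> j. 1"] by simp
  then show "partial i (fun_tilde \<rho> f) x
      = ((\<Sum>j\<in>UNIV. partial j f (tilde_inverse \<rho> x)) - \<rho> * partial i f (tilde_inverse \<rho> x))
        / (real CARD('n) - \<rho>)"
    by (simp add: partial_eq_derivative[OF der] partial_eq_derivative[OF D] ax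
        linear_diff[OF lin] linear_cmul[OF lin])
qed

section \<open>Uniform lower bound for the transformed derivatives\<close>

theorem proposition3p2:
  fixes \<Gamma> :: "(real^'n::{finite,linorder}) set" and \<tau> \<rho> :: real
  assumes "symmetric_open_cone \<Gamma>"
    and "theta_constant \<Gamma> \<tau>"
    and "\<rho> < 1 / (1 - real (kappa \<Gamma>) * \<tau>)"
    and "\<rho> \<noteq> 0"
  shows "\<rho> < real CARD('n) \<and>
    (\<exists>\<theta>>0. \<forall>f. admissible_function \<Gamma> f \<longrightarrow>
       (\<forall>x\<in>cone_tilde \<rho> \<Gamma>. fun_tilde \<rho> f differentiable (at x) \<and>
          (\<forall>i. partial i (fun_tilde \<rho> f) x \<ge> \<theta> * (\<Sum>j\<in>UNIV. partial j (fun_tilde \<rho> f) x) \<and>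
               \<theta> * (\<Sum>j\<in>UNIV. partial j (fun_tilde \<rho> f) x) > 0))) \<and>
    (\<forall>f. admissible_function \<Gamma> f \<longrightarrow>
       concave_on (cone_tilde \<rho> \<Gamma>) (fun_tilde \<rho> f) \<and>
       limit_condition (cone_tilde \<rho> \<Gamma>) (fun_tilde \<rho> f))"
proof -
  note \<Gamma> = assms(1) and \<tau> = assms(2)
  define n where "n = real CARD('n)"
  define \<kappa> where "\<kappa> = real (kappa \<Gamma>)"
  have "\<tau> > 0" using \<tau> by (simp add: theta_constant_def)
  have "n > 0" by (simp add: n_def)
  have "\<kappa> \<le> n - 1" using kappa_less_dim[OF \<Gamma>] by (simp add: \<kappa>_def n_def)
  then have "\<kappa> * \<tau> \<le> (n - 1) * \<tau>" using \<open>\<tau> > 0\<close> by simp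
  moreover have "n * \<tau> \<le> 1" using theta_constant_le[OF \<Gamma> \<tau>] by (simp add: n_def)
  \<comment> \<open>From
    \<open>\<kappa> * \<tau> \<le> n * \<tau> - \<tau> \<le> 1 - \<tau>\<close>. Thus the
    denominator in the bound on \<open>\<rho>\<close> is positive.\<close>
  ultimately have \<kappa>\<tau>: "1 - \<kappa> * \<tau> \<ge> \<tau>" by (simp add: algebra_simps)
  then have pos: "1 - \<kappa> * \<tau> > 0" using \<open>\<tau> > 0\<close> by simp
  \<comment> \<open>Together with \<open>\<kappa> \<le> n - 1\<close> this gives
    \<open>n * (1 - \<kappa> * \<tau>) \<ge> 1\<close>, hence \<open>\<rho> < n\<close>.\<close>
  have "n * (\<kappa> * \<tau>) \<le> \<kappa>"
    using mult_left_mono[OF \<open>n * \<tau> \<le> 1\<close>, of \<kappa>] by (simp add: \<kappa>_def mult_ac)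
  then have "1 / (1 - \<kappa> * \<tau>) \<le> n"
    using pos \<open>\<kappa> \<le> n - 1\<close> by (simp add: divide_le_eq algebra_simps)
  then have "\<rho> < n" using assms(3) by (simp add: \<kappa>_def)
  have "\<rho> * (1 - \<kappa> * \<tau>) < 1" using assms(3) pos by (simp add: \<kappa>_def field_simps)
  \<comment> \<open>A lower bound for \<open>(F - \<rho> f\<^sub>i) / F\<close> in both cases: 1
    works for negative \<open>\<rho>\<close>, the other entry for positive \<open>\<rho>\<close>. It
    involves neither \<open>f\<close> nor the point, so \<open>\<theta>\<close> is uniform.\<close>
  define c where "c = min 1 (1 - \<rho> * (1 - \<kappa> * \<tau>))"
  have "c > 0" using \<open>\<rho> * (1 - \<kappa> * \<tau>) < 1\<close> by (simp add: c_def)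
  define \<theta> where "\<theta> = c / (n - \<rho>)"
  have "\<theta> > 0" using \<open>c > 0\<close> \<open>\<rho> < n\<close> by (simp add: \<theta>_def)
  have tilde: "cone_tilde \<rho> \<Gamma> = tilde_inverse \<rho> -` \<Gamma>"
    using cone_tilde_eq assms(4) \<open>\<rho> < n\<close> by (simp add: n_def)
  have "fun_tilde \<rho> f differentiable (at x) \<and>
      (\<forall>i. partial i (fun_tilde \<rho> f) x \<ge> \<theta> * (\<Sum>j\<in>UNIV. partial j (fun_tilde \<rho> f) x) \<and>
           \<theta> * (\<Sum>j\<in>UNIV. partial j (fun_tilde \<rho> f) x) > 0)"
    if f: "admissible_function \<Gamma> f" and x: "x \<in> cone_tilde \<rho> \<Gamma>" for f x
  proof -
    define y where "y = tilde_inverse \<rho> x"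
    have y: "y \<in> \<Gamma>" using x by (simp add: tilde y_def)
    define F where "F = (\<Sum>j\<in>UNIV. partial j f y)"
    have "F > 0" unfolding F_def by (rule admissible_partials[OF \<Gamma> f y])
    note der = fun_tilde_derivative[OF \<open>\<rho> < n\<close>[unfolded n_def]
        admissible_differentiable[OF f y, unfolded y_def], folded y_def n_def, folded F_def]
    \<comment> \<open>Summing the derivative formula over all indices cancels
      \<open>n - \<rho>\<close>: the transformation keeps the sum of the derivatives equal to
      \<open>F\<close>.\<close>
    have "(\<Sum>j\<in>UNIV. partial j (fun_tilde \<rho> f) x) = (n * F - \<rho> * F) / (n - \<rho>)"
      by (simp add: der(2) sum_subtractf n_def F_def flip: sum_divide_distrib sum_distrib_left)
    then have sum: "(\<Sum>j\<in>UNIV. partial j (fun_tilde \<rho> f) x) = F"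
      using \<open>\<rho> < n\<close> by (simp flip: left_diff_distrib)
    have "\<theta> * F \<le> partial i (fun_tilde \<rho> f) x" for i
    proof -
      have "c * F \<le> F - \<rho> * partial i f y"
      proof (cases "\<rho> \<ge> 0")
        case True
        have "c * F \<le> (1 - \<rho> * (1 - \<kappa> * \<tau>)) * F"
          using \<open>F > 0\<close> by (intro mult_right_mono) (auto simp: c_def)
        also have "\<dots> = F - \<rho> * ((1 - \<kappa> * \<tau>) * F)" by (simp add: algebra_simps)
        also have "\<dots> \<le> F - \<rho> * partial i f y"
          using partial_le_fraction_of_sum[OF \<Gamma> \<tau> kappa_less_dim[OF \<Gamma>] f y, of i] True
          by (intro diff_left_mono mult_left_mono) (simp_all add: F_def \<kappa>_def)
        finally show ?thesis .
      next
        case False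
        then have "\<rho> * partial i f y \<le> 0"
          using admissible_partials(1)[OF \<Gamma> f y, of i] by (simp add: mult_nonpos_nonneg)
        moreover have "c * F \<le> 1 * F" using \<open>F > 0\<close> by (intro mult_right_mono) (auto simp: c_def)
        ultimately show ?thesis by simp
      qed
      then show ?thesis using \<open>\<rho> < n\<close> by (simp add: der(2) \<theta>_def divide_right_mono)
    qed
    then show ?thesis using der(1) \<open>F > 0\<close> \<open>\<theta> > 0\<close> by (simp add: sum)
  qed
  \<comment> \<open>Concavity and the growth condition pass to preimages under the linear map
    \<open>tilde_inverse \<rho>\<close>.\<close>
  moreover have "concave_on (cone_tilde \<rho> \<Gamma>) (fun_tilde \<rho> f) \<and>
      limit_condition (cone_tilde \<rho> \<Gamma>) (fun_tilde \<rho> f)" if "admissible_function \<Gamma> f" for f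
    using that concave_on_linear_vimage[OF _ linear_tilde_inverse]
      limit_condition_linear_vimage[OF _ linear_tilde_inverse]
    unfolding tilde fun_tilde_eq[abs_def] admissible_function_def by blast
  ultimately show ?thesis using \<open>\<rho> < n\<close> \<open>\<theta> > 0\<close> unfolding n_def by blast
qed

end
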